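(* Let $d_1,\dots,d_m$ be positive integers. Then there exists a polynomial $\psi$ in the coefficients of polynomials $g_j\in\mathbb{R}[x]_{d_j}$, $j=1,\dots,m$, such that if $\psi$ does not vanish at the input data (the coefficients of $g_1,\dots,g_m$), then $C(g)$ with $g:=(g_1,\dots,g_m)$ is empty.
   Context: Let $n,m\ge 1$ and $x=(x_1,\dots,x_n)$. $\mathbb{R}[x]_d$ denotes the set of real polynomials in $x$ of degree at most $d$. For $g=(g_1,\dots,g_m)$ and $x\in\mathbb{R}^n$, $\varphi^g(x)$ is the real $(n+m)\times m$ matrix whose $j$-th column is the gradient $\nabla g_j(x)$ followed by $g_j(x)e_j$, with $e_j$ the $j$-th standard basis vector of $\mathbb{R}^m$ (the Jacobian $[\nabla g_1(x)\ \cdots\ \nabla g_m(x)]$ stacked on top of $\mathrm{diag}(g_1(x),\dots,g_m(x))$). The set of critical points is $C(g):=\{x\in\mathbb{R}^n : \mathrm{rank}(\varphi^g(x))<m\}$. *)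

theory Defs
  imports "HOL-Analysis.Analysis" "HOL-Library.Poly_Mapping"
begin

text \<open>
  A real polynomial in variables indexed by a type is a finitely supported map from
  exponent vectors (themselves finitely supported) to coefficients.
\<close>

type_synonym 'v expo = "'v \<Rightarrow>\<^sub>0 nat"
type_synonym 'v rpoly = "'v expo \<Rightarrow>\<^sub>0 real"

definition expo_degree :: "'v expo \<Rightarrow> nat" where
  "expo_degree \<alpha> = (\<Sum>v\<in>Poly_Mapping.keys \<alpha>. Poly_Mapping.lookup \<alpha> v)"

definition peval :: "('v \<Rightarrow> real) \<Rightarrow> 'v rpoly \<Rightarrow> real" where
  "peval a p = (\<Sum>\<alpha>\<in>Poly_Mapping.keys p. Poly_Mapping.lookup p \<alpha> * (\<Prod>v\<in>Poly_Mapping.keys \<alpha>. a v ^ Poly_Mapping.lookup \<alpha> v))"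

definition pvars :: "'v rpoly \<Rightarrow> 'v set" where
  "pvars p = (\<Union>\<alpha>\<in>Poly_Mapping.keys p. Poly_Mapping.keys \<alpha>)"

definition polys_upto :: "nat \<Rightarrow> 'v rpoly set" where
  "polys_upto d = {p. \<forall>\<alpha>\<in>Poly_Mapping.keys p. expo_degree \<alpha> \<le> d}"

definition pfun :: "'n::finite rpoly \<Rightarrow> real ^ 'n \<Rightarrow> real" where
  "pfun p x = peval (\<lambda>i. x $ i) p"

definition gradient :: "(real ^ 'n \<Rightarrow> real) \<Rightarrow> real ^ 'n \<Rightarrow> real ^ 'n" where
  "gradient f x = (\<chi> i. frechet_derivative f (at x) (axis i 1))"

text \<open>
  The \<open>n + m\<close> rows are indexed by the sum type: \<open>Inl\<close> for the Jacobian block,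
  \<open>Inr\<close> for the diagonal block.
\<close>

definition phi :: "('m::finite \<Rightarrow> 'n::finite rpoly) \<Rightarrow> real ^ 'n \<Rightarrow> real ^ 'm ^ ('n + 'm)" where
  "phi g x = (\<chi> r j. case r of
      Inl i \<Rightarrow> gradient (pfun (g j)) x $ i
    | Inr k \<Rightarrow> (pfun (g j) x *\<^sub>R axis j 1) $ k)"

definition critical_points :: "('m::finite \<Rightarrow> 'n::finite rpoly) \<Rightarrow> (real ^ 'n) set" where
  "critical_points g = {x. rank (phi g x) < CARD('m)}"

text \<open>
  The pair \<open>(j, \<alpha>)\<close> names the coefficient of the monomial with exponent \<open>\<alpha>\<close> in the
  \<open>j\<close>-th polynomial; only exponents of degree at most \<open>d j\<close> are input data. Coefficients
  of higher degree vanish identically on the inputs and must not occur in a polynomial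
  in the input data.
\<close>

definition coeff_index :: "('m \<Rightarrow> nat) \<Rightarrow> ('m \<times> 'n expo) set" where
  "coeff_index d = {(j, \<alpha>). expo_degree \<alpha> \<le> d j}"

definition coeff_data :: "('m \<Rightarrow> 'n rpoly) \<Rightarrow> 'm \<times> 'n expo \<Rightarrow> real" where
  "coeff_data g = (\<lambda>(j, \<alpha>). Poly_Mapping.lookup (g j) \<alpha>)"

text \<open>Polynomial functions are differentiable, so the gradient above is the actual one.\<close>

lemma pfun_differentiable:
  fixes p :: "'n::finite rpoly"
  shows "pfun p differentiable (at x)"
proof -
  have m: "(\<lambda>x::real ^ 'n. \<Prod>v\<in>K. (x $ v) ^ k v) differentiable (at x)"
    if "finite K" for K and k :: "'n \<Rightarrow> nat"
    using that
  proof (induction K rule: finite_induct)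
    case (insert v K)
    have "(\<lambda>x::real ^ 'n. x $ v) differentiable (at x)"
      by (intro bounded_linear_imp_differentiable bounded_linear_vec_nth)
    then show ?case
      using insert by (simp add: differentiable_mult differentiable_power)
  qed simp
  have "(\<lambda>x. \<Sum>\<alpha>\<in>Poly_Mapping.keys p. Poly_Mapping.lookup p \<alpha> * (\<Prod>v\<in>Poly_Mapping.keys \<alpha>. (x $ v) ^ Poly_Mapping.lookup \<alpha> v))
      differentiable (at x)"
    by (intro differentiable_sum differentiable_mult differentiable_const m ballI finite_keys)
  then show ?thesis
    by (simp add: pfun_def[abs_def] peval_def)
qed

lemma GDERIV_gradient:
  assumes "f differentiable (at x)"
  shows "GDERIV f x :> gradient f x"
proof -
  let ?D = "frechet_derivative f (at x)"
  have D: "(f has_derivative ?D) (at x)"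
    using assms by (simp add: frechet_derivative_works)
  then have lin: "linear ?D"
    by (rule has_derivative_linear)
  have "?D h = inner h (gradient f x)" for h
  proof -
    have "?D h = ?D (\<Sum>i\<in>UNIV. (h $ i) *\<^sub>R axis i 1)"
      by (rule arg_cong[of _ _ ?D]) (simp add: basis_expansion flip: scalar_mult_eq_scaleR)
    also have "\<dots> = (\<Sum>i\<in>UNIV. (h $ i) * ?D (axis i 1))"
      by (simp add: linear_sum[OF lin] linear_cmul[OF lin])
    finally show ?thesis
      by (simp add: gradient_def inner_vec_def)
  qed
  then have "?D = (\<lambda>h. inner h (gradient f x))"
    by blast
  with D show ?thesis
    by (simp add: gderiv_def)
qed

end

theory Submission
  imports Defs
begin

text \<open>
  A critical point \<open>x\<close> of \<open>g\<close> comes with multipliers \<open>\<lambda> \<noteq> 0\<close> such that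
  \<open>\<Sum>\<^sub>j \<lambda>\<^sub>j \<nabla>g\<^sub>j(x) = 0\<close> and \<open>g\<^sub>j(x) = 0\<close> whenever \<open>\<lambda>\<^sub>j \<noteq> 0\<close>. Fix the support \<open>J\<close> of
  \<open>\<lambda>\<close> and normalize \<open>\<lambda>\<^sub>j = -1\<close> for one \<open>j = j0\<close> in \<open>J\<close>. The gradient equation can then be solved
  for the \<open>n\<close> linear coefficients of \<open>g\<^sub>j\<^sub>0\<close>, and the equations \<open>g\<^sub>j(x) = 0\<close>, \<open>j \<in> J\<close>, for the constant
  coefficients. So the \<open>N\<close> coefficients of \<open>g\<close> are polynomial functions of
  \<open>(N - n - |J|) + n + (|J| - 1) = N - 1\<close> parameters, and a dimension count yields a nonzero
  polynomial that vanishes on the images of all these finitely many polynomial maps.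
\<close>

section \<open>Underdetermined homogeneous linear systems\<close>

text \<open>Gaussian elimination, by induction on the equations: a new equation with a nonzero
  coefficient serves to eliminate one unknown, so the unknowns still outnumber the remaining
  equations.\<close>

lemma underdetermined_system:
  fixes c :: "'a \<Rightarrow> 'b \<Rightarrow> real"
  assumes "finite B" "finite G" "card B < card G"
  shows "\<exists>a. (\<exists>x\<in>G. a x \<noteq> 0) \<and> (\<forall>b\<in>B. (\<Sum>x\<in>G. a x * c x b) = 0)"
  using assms
proof (induction B arbitrary: G c rule: finite_induct)
  case empty
  then show ?case
    by (intro exI[of _ "\<lambda>_. 1"]) (auto simp: card_gt_0_iff)
next
  case (insert b B)
  show ?case
  proof (cases "\<forall>x\<in>G. c x b = 0")
    case True
    with insert.IH[of G c] insert.prems insert.hyps show ?thesis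
      by auto
  next
    case False
    then obtain p where p: "p \<in> G" "c p b \<noteq> 0"
      by blast
    \<comment> \<open>Subtracting \<open>c p y / c p b\<close> times equation \<open>b\<close> from
      equation \<open>y\<close> removes the pivot unknown \<open>p\<close>.\<close>
    define c' where "c' x y = c x y - c x b / c p b * c p y" for x y
    have "card B < card (G - {p})"
      using insert.prems insert.hyps p by simp
    then obtain a where a: "\<exists>x\<in>G - {p}. a x \<noteq> 0"
        "\<And>y. y \<in> B \<Longrightarrow> (\<Sum>x\<in>G - {p}. a x * c' x y) = 0"
      using insert.IH[of "G - {p}" c'] insert.prems by auto
    define s where "s = (\<Sum>x\<in>G - {p}. a x * c x b)"
    \<comment> \<open>Back substitution: the value at \<open>p\<close> is the one that makes
      equation \<open>b\<close> hold.\<close>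
    define a' where "a' x = (if x = p then - s / c p b else a x)" for x
    have sum': "(\<Sum>x\<in>G. a' x * c x y) = (\<Sum>x\<in>G - {p}. a x * c x y) - s / c p b * c p y" for y
    proof -
      have "(\<Sum>x\<in>G - {p}. a' x * c x y) = (\<Sum>x\<in>G - {p}. a x * c x y)"
        by (rule sum.cong) (auto simp: a'_def)
      then show ?thesis
        by (subst sum.remove[OF insert.prems(1) p(1)]) (simp add: a'_def)
    qed
    have "(\<Sum>x\<in>G. a' x * c x y) = (\<Sum>x\<in>G - {p}. a x * c' x y)" for y
      unfolding sum' s_def c'_def
      by (simp add: algebra_simps sum_subtractf sum_distrib_left sum_distrib_right sum_divide_distrib)
    then have "\<forall>y\<in>B. (\<Sum>x\<in>G. a' x * c x y) = 0"
      using a(2) by simp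
    moreover have "(\<Sum>x\<in>G. a' x * c x b) = 0"
      unfolding sum' using p by (simp add: s_def)
    moreover have "\<exists>x\<in>G. a' x \<noteq> 0"
      using a(1) by (auto simp: a'_def)
    ultimately show ?thesis
      by blast
  qed
qed

section \<open>Polynomial functions with bounded exponents\<close>

text \<open>Polynomials are treated as functions because only their composites are compared. The
  bound \<open>e\<close> limits the exponent of each variable separately, so the admissible
  monomials form a box of exactly \<open>(e + 1) ^ card A\<close> elements.\<close>

inductive polyfn :: "'a set \<Rightarrow> nat \<Rightarrow> (('a \<Rightarrow> real) \<Rightarrow> real) \<Rightarrow> bool"
  for A e where
  monomial: "(\<And>a. a \<in> A \<Longrightarrow> \<beta> a \<le> e) \<Longrightarrow> polyfn A e (\<lambda>t. \<Prod>a\<in>A. t a ^ \<beta> a)"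
| zero: "polyfn A e (\<lambda>t. 0)"
| add: "polyfn A e f \<Longrightarrow> polyfn A e h \<Longrightarrow> polyfn A e (\<lambda>t. f t + h t)"
| scale: "polyfn A e f \<Longrightarrow> polyfn A e (\<lambda>t. c * f t)"

lemma polyfn_mono:
  assumes "polyfn A e f" "e \<le> e'"
  shows "polyfn A e' f"
  using assms by induction (auto intro: polyfn.intros dest: order_trans)

lemma polyfn_mult:
  assumes "polyfn A e f" "polyfn A e' h"
  shows "polyfn A (e + e') (\<lambda>t. f t * h t)"
  using assms(1)
proof induction
  case (monomial \<beta>)
  show ?case
    using assms(2)
  proof induction
    case (monomial \<beta>')
    have "polyfn A (e + e') (\<lambda>t. \<Prod>a\<in>A. t a ^ (\<beta> a + \<beta>' a))"
      using \<open>\<And>a. a \<in> A \<Longrightarrow> \<beta> a \<le> e\<close> monomial by (intro polyfn.monomial add_mono)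
    then show ?case
      by (simp add: power_add prod.distrib)
  qed (auto simp: distrib_left mult.left_commute intro: polyfn.intros)
qed (auto simp: distrib_right mult.assoc intro: polyfn.intros)

lemma polyfn_const: "polyfn A e (\<lambda>t. c)"
  using polyfn.scale[OF polyfn.monomial[of A "\<lambda>_. 0" e], of c] by simp

lemma polyfn_power:
  assumes "polyfn A e f"
  shows "polyfn A (n * e) (\<lambda>t. f t ^ n)"
proof (induction n)
  case (Suc n)
  then show ?case
    using polyfn_mult[OF assms Suc] by simp
qed (simp add: polyfn_const)

lemma polyfn_prod:
  assumes "\<And>v. v \<in> V \<Longrightarrow> polyfn A (e v) (f v)"
  shows "polyfn A (\<Sum>v\<in>V. e v) (\<lambda>t. \<Prod>v\<in>V. f v t)"
  using assms
  by (induction V rule: infinite_finite_induct) (auto intro: polyfn_const polyfn_mult)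

text \<open>This turns the exponent bound into a dimension bound: the function lies in the span of a
  finite family of monomials that depends only on \<open>A\<close> and \<open>e\<close>.\<close>

lemma polyfn_coefficients:
  assumes "polyfn A e f" "finite A"
  shows "\<exists>c. \<forall>t. f t = (\<Sum>\<beta>\<in>PiE A (\<lambda>_. {..e}). c \<beta> * (\<Prod>a\<in>A. t a ^ \<beta> a))"
  using assms(1)
proof induction
  case (monomial \<beta>)
  have fin: "finite (PiE A (\<lambda>_. {..e}))"
    using assms(2) by (simp add: finite_PiE)
  have "(\<Sum>\<beta>'\<in>PiE A (\<lambda>_. {..e}). (if \<beta>' = restrict \<beta> A then 1 else 0) * (\<Prod>a\<in>A. t a ^ \<beta>' a))
      = (\<Prod>a\<in>A. t a ^ \<beta> a)" for t :: "'a \<Rightarrow> real"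
  proof -
    \<comment> \<open>Outside \<open>A\<close> the exponent function is arbitrary;
      \<open>restrict\<close> picks its representative in the finite index set.\<close>
    have "restrict \<beta> A \<in> PiE A (\<lambda>_. {..e})"
      using monomial by auto
    then show ?thesis
      using fin by (simp add: if_distrib[of "\<lambda>x. x * _"] sum.delta' cong: if_cong)
  qed
  then show ?case
    by (intro exI[of _ "\<lambda>\<beta>'. if \<beta>' = restrict \<beta> A then 1 else 0"]) simp
next
  case zero
  then show ?case
    by (intro exI[of _ "\<lambda>_. 0"]) simp
next
  case (add f h)
  then obtain c c' where "\<forall>t. f t = (\<Sum>\<beta>\<in>PiE A (\<lambda>_. {..e}). c \<beta> * (\<Prod>a\<in>A. t a ^ \<beta> a))"
      "\<forall>t. h t = (\<Sum>\<beta>\<in>PiE A (\<lambda>_. {..e}). c' \<beta> * (\<Prod>a\<in>A. t a ^ \<beta> a))"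
    by blast
  then show ?case
    by (intro exI[of _ "\<lambda>\<beta>. c \<beta> + c' \<beta>"]) (simp add: distrib_right sum.distrib)
next
  case (scale f r)
  then obtain c where "\<forall>t. f t = (\<Sum>\<beta>\<in>PiE A (\<lambda>_. {..e}). c \<beta> * (\<Prod>a\<in>A. t a ^ \<beta> a))"
    by blast
  then show ?case
    by (intro exI[of _ "\<lambda>\<beta>. r * c \<beta>"]) (simp add: sum_distrib_left mult.assoc)
qed

text \<open>Forgetting the exponent bound leaves closure rules that can be applied without tracking
  degrees.\<close>

definition polynomial_on :: "'a set \<Rightarrow> (('a \<Rightarrow> real) \<Rightarrow> real) \<Rightarrow> bool" where
  "polynomial_on A f \<longleftrightarrow> (\<exists>e. polyfn A e f)"

lemma polynomial_on_const: "polynomial_on A (\<lambda>t. c)"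
  by (auto simp: polynomial_on_def intro: polyfn_const)

lemma polynomial_on_var:
  assumes "finite A" "a \<in> A"
  shows "polynomial_on A (\<lambda>t. t a)"
proof -
  have "polyfn A 1 (\<lambda>t. \<Prod>b\<in>A. t b ^ (if b = a then 1 else 0))"
    by (rule polyfn.monomial) simp
  moreover have "(\<Prod>b\<in>A. t b ^ (if b = a then 1 else 0)) = t a" for t :: "'a \<Rightarrow> real"
    using assms by (simp add: if_distrib[of "\<lambda>n. _ ^ n"] prod.delta cong: if_cong)
  ultimately show ?thesis
    by (auto simp: polynomial_on_def)
qed

lemma polynomial_on_add:
  assumes "polynomial_on A f" "polynomial_on A h"
  shows "polynomial_on A (\<lambda>t. f t + h t)"
proof -
  obtain e e' where "polyfn A e f" "polyfn A e' h"
    using assms by (auto simp: polynomial_on_def)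
  then have "polyfn A (max e e') (\<lambda>t. f t + h t)"
    by (auto intro!: polyfn.add elim: polyfn_mono)
  then show ?thesis
    by (auto simp: polynomial_on_def)
qed

lemma polynomial_on_mult:
  assumes "polynomial_on A f" "polynomial_on A h"
  shows "polynomial_on A (\<lambda>t. f t * h t)"
  using assms by (auto simp: polynomial_on_def intro: polyfn_mult)

lemma polynomial_on_uminus:
  assumes "polynomial_on A f"
  shows "polynomial_on A (\<lambda>t. - f t)"
  using polynomial_on_mult[OF polynomial_on_const[of A "-1"] assms] by simp

lemma polynomial_on_diff:
  assumes "polynomial_on A f" "polynomial_on A h"
  shows "polynomial_on A (\<lambda>t. f t - h t)"
  using polynomial_on_add[OF assms(1) polynomial_on_uminus[OF assms(2)]] by simp

lemma polynomial_on_power: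
  assumes "polynomial_on A f"
  shows "polynomial_on A (\<lambda>t. f t ^ n)"
  using assms by (auto simp: polynomial_on_def intro: polyfn_power)

lemma polynomial_on_sum:
  assumes "\<And>v. v \<in> V \<Longrightarrow> polynomial_on A (f v)"
  shows "polynomial_on A (\<lambda>t. \<Sum>v\<in>V. f v t)"
  using assms
  by (induction V rule: infinite_finite_induct) (auto intro: polynomial_on_const polynomial_on_add)

lemma polynomial_on_prod:
  assumes "\<And>v. v \<in> V \<Longrightarrow> polynomial_on A (f v)"
  shows "polynomial_on A (\<lambda>t. \<Prod>v\<in>V. f v t)"
  using assms
  by (induction V rule: infinite_finite_induct) (auto intro: polynomial_on_const polynomial_on_mult)

section \<open>A nonzero polynomial vanishing on finitely many images, by dimension count\<close>

text \<open>Bounding each exponent instead of the total degree makes the number of monomials an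
  exact power.\<close>

definition box_expos :: "'v set \<Rightarrow> nat \<Rightarrow> 'v expo set" where
  "box_expos V D = {\<gamma>. Poly_Mapping.keys \<gamma> \<subseteq> V \<and> (\<forall>v. Poly_Mapping.lookup \<gamma> v \<le> D)}"

lemma bij_betw_box_expos:
  assumes "finite V"
  shows "bij_betw (\<lambda>\<gamma>. restrict (Poly_Mapping.lookup \<gamma>) V) (box_expos V D) (PiE V (\<lambda>_. {..D}))"
proof (rule bij_betw_byWitness[where f' = "\<lambda>f. Abs_poly_mapping (\<lambda>v. if v \<in> V then f v else 0)"])
  have lookup: "Poly_Mapping.lookup (Abs_poly_mapping (\<lambda>v. if v \<in> V then f v else 0))
      = (\<lambda>v. if v \<in> V then f v else 0)" for f :: "'a \<Rightarrow> nat"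
    by (rule Abs_poly_mapping_inverse) (auto intro: finite_subset[OF _ assms])
  show "\<forall>\<gamma>\<in>box_expos V D.
      Abs_poly_mapping (\<lambda>v. if v \<in> V then restrict (Poly_Mapping.lookup \<gamma>) V v else 0) = \<gamma>"
    by (auto intro!: poly_mapping_eqI simp: lookup box_expos_def in_keys_iff)
  show "\<forall>f\<in>PiE V (\<lambda>_. {..D}).
      restrict (Poly_Mapping.lookup (Abs_poly_mapping (\<lambda>v. if v \<in> V then f v else 0))) V = f"
    by (auto simp: lookup PiE_def extensional_def)
  show "(\<lambda>\<gamma>. restrict (Poly_Mapping.lookup \<gamma>) V) ` box_expos V D \<subseteq> PiE V (\<lambda>_. {..D})"
    by (auto simp: box_expos_def)
  show "(\<lambda>f. Abs_poly_mapping (\<lambda>v. if v \<in> V then f v else 0)) ` PiE V (\<lambda>_. {..D}) \<subseteq> box_expos V D"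
    by (auto simp: box_expos_def lookup in_keys_iff split: if_splits)
qed

lemma
  assumes "finite V"
  shows finite_box_expos: "finite (box_expos V D)"
    and card_box_expos: "card (box_expos V D) = (D + 1) ^ card V"
  using bij_betw_finite[OF bij_betw_box_expos[OF assms, of D]]
    bij_betw_same_card[OF bij_betw_box_expos[OF assms, of D]] assms
  by (simp_all add: finite_PiE card_PiE)

text \<open>
  The polynomials of degree at most \<open>D\<close> in each of \<open>N\<close> variables form a space of dimension
  \<open>(D + 1) ^ N\<close>, whereas their compositions with maps in at most \<open>N - 1\<close> parameters lie in a
  space whose dimension is only of order \<open>D ^ (N - 1)\<close>.
\<close>

lemma exists_poly_vanishing_on_images:
  fixes F :: "'k \<Rightarrow> ('a \<Rightarrow> real) \<Rightarrow> 'v \<Rightarrow> real"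
  assumes "finite K" "finite V"
    and A: "\<And>k. k \<in> K \<Longrightarrow> finite (A k)" "\<And>k. k \<in> K \<Longrightarrow> card (A k) < card V"
    and F: "\<And>k v. k \<in> K \<Longrightarrow> v \<in> V \<Longrightarrow> polynomial_on (A k) (\<lambda>t. F k t v)"
  shows "\<exists>\<psi>. \<psi> \<noteq> 0 \<and> pvars \<psi> \<subseteq> V \<and>
    (\<forall>k\<in>K. \<forall>t y. (\<forall>v\<in>V. y v = F k t v) \<longrightarrow> peval y \<psi> = 0)"
proof -
  obtain e0 where e0: "\<And>k v. k \<in> K \<Longrightarrow> v \<in> V \<Longrightarrow> polyfn (A k) (e0 k v) (\<lambda>t. F k t v)"
    using F unfolding polynomial_on_def by metis
  \<comment> \<open>The sum serves as a common upper bound for the finitely many individual exponent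
    bounds.\<close>
  define e where "e = (\<Sum>k\<in>K. \<Sum>v\<in>V. e0 k v)"
  have e: "polyfn (A k) e (\<lambda>t. F k t v)" if "k \<in> K" "v \<in> V" for k v
  proof (rule polyfn_mono[OF e0[OF that]])
    have "e0 k v \<le> (\<Sum>v\<in>V. e0 k v)"
      using that assms by (intro member_le_sum) auto
    also have "\<dots> \<le> e"
      unfolding e_def using that assms by (intro member_le_sum) auto
    finally show "e0 k v \<le> e" .
  qed
  define N where "N = card V"
  \<comment> \<open>Chosen to win the count. Since \<open>E + 1 \<le> (D + 1) * (N * e + 1)\<close>,
    there are at most \<open>card K * (E + 1) ^ (N - 1) \<le> D * (D + 1) ^ (N - 1)\<close>
    equations, fewer than the \<open>(D + 1) ^ N\<close> unknowns.\<close>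
  define D where "D = card K * (N * e + 1) ^ (N - 1)"
  \<comment> \<open>Exponent bound for a composed monomial: \<open>N\<close> factors, each a power
    at most \<open>D\<close> of a function with exponents at most \<open>e\<close>.\<close>
  define E where "E = N * (D * e)"
  define G where "G = box_expos V D"
  define B where "B k = PiE (A k) (\<lambda>_. {..E})" for k
  have finG: "finite G"
    unfolding G_def by (rule finite_box_expos) fact
  have finB: "finite (B k)" if "k \<in> K" for k
    unfolding B_def using A that by (simp add: finite_PiE)
  have "polyfn (A k) E (\<lambda>t. \<Prod>v\<in>V. F k t v ^ Poly_Mapping.lookup \<gamma> v)"
    if "k \<in> K" "\<gamma> \<in> G" for k \<gamma>
  proof (rule polyfn_mono)
    show "polyfn (A k) (\<Sum>v\<in>V. Poly_Mapping.lookup \<gamma> v * e) (\<lambda>t. \<Prod>v\<in>V. F k t v ^ Poly_Mapping.lookup \<gamma> v)"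
      using e that by (intro polyfn_prod polyfn_power)
    have "(\<Sum>v\<in>V. Poly_Mapping.lookup \<gamma> v * e) \<le> (\<Sum>v\<in>V. D * e)"
      using that by (intro sum_mono mult_right_mono) (auto simp: G_def box_expos_def)
    then show "(\<Sum>v\<in>V. Poly_Mapping.lookup \<gamma> v * e) \<le> E"
      by (simp add: E_def N_def)
  qed
  then have "\<exists>c. \<forall>t. (\<Prod>v\<in>V. F k t v ^ Poly_Mapping.lookup \<gamma> v) = (\<Sum>\<beta>\<in>B k. c \<beta> * (\<Prod>a\<in>A k. t a ^ \<beta> a))"
    if "k \<in> K" "\<gamma> \<in> G" for k \<gamma>
    unfolding B_def using that A by (intro polyfn_coefficients) auto
  then obtain c where c: "\<And>k \<gamma> t. k \<in> K \<Longrightarrow> \<gamma> \<in> G \<Longrightarrow>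
      (\<Prod>v\<in>V. F k t v ^ Poly_Mapping.lookup \<gamma> v) = (\<Sum>\<beta>\<in>B k. c k \<gamma> \<beta> * (\<Prod>a\<in>A k. t a ^ \<beta> a))"
    by metis
  have card: "card (Sigma K B) < card G"
  proof (cases "K = {}")
    case True
    then show ?thesis
      using assms(2) by (simp add: G_def card_box_expos)
  next
    case False
    \<comment> \<open>This makes \<open>N - 1\<close> a true predecessor, so that
      \<open>(D + 1) * (D + 1) ^ (N - 1)\<close> is the cardinality of \<open>G\<close>.\<close>
    then have "N \<noteq> 0"
      using A(2) unfolding N_def by fastforce
    have "card (B k) \<le> (E + 1) ^ (N - 1)" if "k \<in> K" for k
    proof -
      have "card (B k) = (E + 1) ^ card (A k)"
        unfolding B_def using A that by (simp add: card_PiE)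
      also have "\<dots> \<le> (E + 1) ^ (N - 1)"
        using A(2)[OF that] by (intro power_increasing) (auto simp: N_def)
      finally show ?thesis .
    qed
    then have "card (Sigma K B) \<le> card K * (E + 1) ^ (N - 1)"
      using assms(1) finB sum_bounded_above[of K "\<lambda>k. card (B k)" "(E + 1) ^ (N - 1)"]
      by simp
    also have "(E + 1) ^ (N - 1) \<le> ((D + 1) * (N * e + 1)) ^ (N - 1)"
      by (intro power_mono) (auto simp: E_def algebra_simps)
    then have "card K * (E + 1) ^ (N - 1) \<le> D * (D + 1) ^ (N - 1)"
      unfolding D_def power_mult_distrib by (metis mult.assoc mult.commute mult_le_mono2)
    also have "\<dots> < (D + 1) * (D + 1) ^ (N - 1)"
      by simp
    also have "\<dots> = card G"
      using \<open>N \<noteq> 0\<close> assms(2)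
      by (simp only: G_def card_box_expos N_def neq0_conv power_minus_mult mult.commute[of "D + 1"])
    finally show ?thesis .
  qed
  \<comment> \<open>The unknowns are the coefficients of \<psi>, indexed by \<open>G\<close>. The
    equation for \<open>(k, \<beta>)\<close> makes the coefficient of the parameter monomial \<beta>
    in the composite of \<psi> with \<open>F k\<close> vanish.\<close>
  obtain a where a: "\<exists>\<gamma>\<in>G. a \<gamma> \<noteq> 0" "\<And>k \<beta>. k \<in> K \<Longrightarrow> \<beta> \<in> B k \<Longrightarrow> (\<Sum>\<gamma>\<in>G. a \<gamma> * c k \<gamma> \<beta>) = 0"
    using underdetermined_system[OF _ finG card, of "\<lambda>\<gamma> (k, \<beta>). c k \<gamma> \<beta>"] assms(1) finB
    by auto
  define \<psi> where "\<psi> = Abs_poly_mapping (\<lambda>\<gamma>. if \<gamma> \<in> G then a \<gamma> else 0)"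
  have lookup: "Poly_Mapping.lookup \<psi> = (\<lambda>\<gamma>. if \<gamma> \<in> G then a \<gamma> else 0)"
    unfolding \<psi>_def by (rule Abs_poly_mapping_inverse) (auto intro: finite_subset[OF _ finG])
  have keys: "Poly_Mapping.keys \<psi> \<subseteq> G"
    by (auto simp: in_keys_iff lookup split: if_splits)
  have keysG: "Poly_Mapping.keys \<gamma> \<subseteq> V" if "\<gamma> \<in> G" for \<gamma>
    using that by (simp add: G_def box_expos_def)
  have eval: "peval y \<psi> = (\<Sum>\<gamma>\<in>G. a \<gamma> * (\<Prod>v\<in>V. y v ^ Poly_Mapping.lookup \<gamma> v))" for y
  proof -
    have "peval y \<psi> = (\<Sum>\<gamma>\<in>G. Poly_Mapping.lookup \<psi> \<gamma> * (\<Prod>v\<in>Poly_Mapping.keys \<gamma>. y v ^ Poly_Mapping.lookup \<gamma> v))"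
      unfolding peval_def using keys finG
      by (intro sum.mono_neutral_left) (auto simp: in_keys_iff)
    also have "\<dots> = (\<Sum>\<gamma>\<in>G. a \<gamma> * (\<Prod>v\<in>V. y v ^ Poly_Mapping.lookup \<gamma> v))"
      using assms(2) keysG
      by (intro sum.cong arg_cong2[where f = times] prod.mono_neutral_left)
        (auto simp: lookup in_keys_iff)
    finally show ?thesis .
  qed
  have "peval y \<psi> = 0" if k: "k \<in> K" and y: "\<forall>v\<in>V. y v = F k t v" for k t y
  proof -
    have "peval y \<psi> = (\<Sum>\<gamma>\<in>G. a \<gamma> * (\<Prod>v\<in>V. F k t v ^ Poly_Mapping.lookup \<gamma> v))"
      using y by (simp add: eval)
    also have "\<dots> = (\<Sum>\<gamma>\<in>G. \<Sum>\<beta>\<in>B k. a \<gamma> * (c k \<gamma> \<beta> * (\<Prod>b\<in>A k. t b ^ \<beta> b)))"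
      using k by (simp add: c sum_distrib_left)
    also have "\<dots> = (\<Sum>\<beta>\<in>B k. (\<Sum>\<gamma>\<in>G. a \<gamma> * c k \<gamma> \<beta>) * (\<Prod>b\<in>A k. t b ^ \<beta> b))"
      by (subst sum.swap) (simp add: sum_distrib_right mult.assoc)
    also have "\<dots> = 0"
      using a(2)[OF k] by simp
    finally show ?thesis .
  qed
  moreover have "pvars \<psi> \<subseteq> V"
    using keys keysG by (auto simp: pvars_def)
  moreover have "\<psi> \<noteq> 0"
    using a(1) lookup by (metis lookup_zero)
  ultimately show ?thesis
    by blast
qed

section \<open>Values and gradients in terms of coefficients\<close>

definition monom_value :: "'n::finite expo \<Rightarrow> ('n \<Rightarrow> real) \<Rightarrow> real" where
  "monom_value \<alpha> x = (\<Prod>i\<in>UNIV. x i ^ Poly_Mapping.lookup \<alpha> i)"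

text \<open>For exponent 0 the truncated \<open>0 - 1\<close> is harmless, since the leading factor
  is 0.\<close>

definition monom_partial :: "'n::finite \<Rightarrow> 'n expo \<Rightarrow> ('n \<Rightarrow> real) \<Rightarrow> real" where
  "monom_partial i \<alpha> x = real (Poly_Mapping.lookup \<alpha> i) * x i ^ (Poly_Mapping.lookup \<alpha> i - 1) *
    (\<Prod>k\<in>UNIV - {i}. x k ^ Poly_Mapping.lookup \<alpha> k)"

definition unit_expo :: "'n \<Rightarrow> 'n expo" where
  "unit_expo i = Poly_Mapping.single i 1"

definition expos_upto :: "nat \<Rightarrow> 'n expo set" where
  "expos_upto d = {\<alpha>. expo_degree \<alpha> \<le> d}"

text \<open>These are the exponents of degree from 2 to \<open>d\<close>; in the polynomial at
  \<open>j0\<close> their coefficients stay free, while the constant and linear ones are solved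
  for.\<close>

definition high_expos :: "nat \<Rightarrow> 'n expo set" where
  "high_expos d = expos_upto d - {0} - range unit_expo"

lemma inj_unit_expo: "inj unit_expo"
  by (rule injI) (metis unit_expo_def lookup_single_eq lookup_single_not_eq zero_neq_one)

lemma unit_expo_nonzero [simp]: "unit_expo i \<noteq> 0"
  by (metis unit_expo_def lookup_single_eq lookup_zero zero_neq_one)

lemma zero_in_expos_upto [simp]: "0 \<in> expos_upto d"
  by (simp add: expos_upto_def expo_degree_def)

lemma unit_expo_in_expos_upto: "d > 0 \<Longrightarrow> unit_expo i \<in> expos_upto d"
  by (simp add: expos_upto_def expo_degree_def unit_expo_def)

lemma finite_expos_upto: "finite (expos_upto d :: 'n::finite expo set)"
proof (rule finite_subset)
  show "expos_upto d \<subseteq> box_expos (UNIV :: 'n set) d"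
  proof
    fix \<alpha> :: "'n expo"
    assume \<alpha>: "\<alpha> \<in> expos_upto d"
    have "Poly_Mapping.lookup \<alpha> i \<le> expo_degree \<alpha>" for i
      unfolding expo_degree_def
      by (cases "i \<in> Poly_Mapping.keys \<alpha>") (auto intro: member_le_sum simp: in_keys_iff)
    with \<alpha> show "\<alpha> \<in> box_expos UNIV d"
      by (auto simp: box_expos_def expos_upto_def intro: order_trans)
  qed
qed (simp add: finite_box_expos)

lemma monom_value_zero [simp]: "monom_value 0 x = 1"
  by (simp add: monom_value_def)

lemma monom_partial_zero [simp]: "monom_partial i 0 x = 0"
  by (simp add: monom_partial_def)

lemma monom_value_unit [simp]: "monom_value (unit_expo i) x = x i"
proof -
  have "monom_value (unit_expo i) x = (\<Prod>k\<in>UNIV. if k = i then x k else 1)"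
    unfolding monom_value_def by (rule prod.cong) (auto simp: unit_expo_def lookup_single when_def)
  then show ?thesis
    by simp
qed

text \<open>At every point the linear coefficients enter the gradient through the identity matrix.
  Hence the gradient equation can always be solved for them.\<close>

lemma monom_partial_unit: "monom_partial i (unit_expo k) x = (if i = k then 1 else 0)"
proof (cases "i = k")
  case True
  have "(\<Prod>l\<in>UNIV - {k}. x l ^ Poly_Mapping.lookup (unit_expo k) l) = 1"
    by (rule prod.neutral) (auto simp: unit_expo_def lookup_single when_def)
  with True show ?thesis
    by (simp add: monom_partial_def) (simp add: unit_expo_def)
qed (simp add: monom_partial_def unit_expo_def lookup_single)

lemma sum_expos_upto:
  fixes f :: "'n::finite expo \<Rightarrow> real"
  shows "(\<Sum>\<alpha>\<in>expos_upto d. f \<alpha>) = f 0 + (\<Sum>\<alpha>\<in>expos_upto d - {0}. f \<alpha>)"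
  by (rule sum.remove) (simp_all add: finite_expos_upto)

text \<open>Separates the linear coefficients from the rest; positivity of \<open>d\<close> ensures
  that they are among the coefficients available.\<close>

lemma sum_nonzero_expos:
  fixes f :: "'n::finite expo \<Rightarrow> real"
  assumes "d > 0"
  shows "(\<Sum>\<alpha>\<in>expos_upto d - {0}. f \<alpha>) = (\<Sum>i\<in>UNIV. f (unit_expo i)) + (\<Sum>\<alpha>\<in>high_expos d. f \<alpha>)"
proof -
  have "(\<Sum>\<alpha>\<in>expos_upto d - {0}. f \<alpha>) = (\<Sum>\<alpha>\<in>high_expos d. f \<alpha>) + sum f (range unit_expo)"
    unfolding high_expos_def using assms
    by (intro sum.subset_diff) (auto simp: unit_expo_in_expos_upto finite_expos_upto)
  moreover have "sum f (range unit_expo) = (\<Sum>i\<in>UNIV. f (unit_expo i))"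
    using sum.reindex[OF inj_unit_expo, of f] by simp
  ultimately show ?thesis
    by simp
qed

lemma pfun_expos:
  fixes p :: "'n::finite rpoly"
  assumes "p \<in> polys_upto d"
  shows "pfun p x = (\<Sum>\<alpha>\<in>expos_upto d. Poly_Mapping.lookup p \<alpha> * monom_value \<alpha> (($) x))"
proof -
  have "(\<Prod>i\<in>Poly_Mapping.keys \<alpha>. x $ i ^ Poly_Mapping.lookup \<alpha> i) = monom_value \<alpha> (($) x)" for \<alpha>
    unfolding monom_value_def by (rule prod.mono_neutral_left) (auto simp: in_keys_iff)
  then have "pfun p x = (\<Sum>\<alpha>\<in>Poly_Mapping.keys p. Poly_Mapping.lookup p \<alpha> * monom_value \<alpha> (($) x))"
    by (simp add: pfun_def peval_def)
  also have "\<dots> = (\<Sum>\<alpha>\<in>expos_upto d. Poly_Mapping.lookup p \<alpha> * monom_value \<alpha> (($) x))"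
    using assms
    by (intro sum.mono_neutral_left finite_expos_upto)
      (auto simp: in_keys_iff polys_upto_def expos_upto_def)
  finally show ?thesis .
qed

lemma monom_value_has_derivative:
  fixes x :: "real ^ 'n::finite"
  shows "((\<lambda>x. monom_value \<alpha> (($) x)) has_derivative
    (\<lambda>h. \<Sum>i\<in>UNIV. h $ i * monom_partial i \<alpha> (($) x))) (at x)"
  unfolding monom_value_def
  by (rule has_derivative_eq_rhs, rule has_derivative_prod, rule has_derivative_power,
      rule bounded_linear_imp_has_derivative, rule bounded_linear_vec_nth)
    (auto simp: monom_partial_def fun_eq_iff intro!: sum.cong)

lemma gradient_expos:
  fixes p :: "'n::finite rpoly"
  assumes "p \<in> polys_upto d"
  shows "gradient (pfun p) x $ i =
    (\<Sum>\<alpha>\<in>expos_upto d. Poly_Mapping.lookup p \<alpha> * monom_partial i \<alpha> (($) x))"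
proof -
  let ?D = "\<lambda>h. \<Sum>\<alpha>\<in>expos_upto d. Poly_Mapping.lookup p \<alpha> * (\<Sum>k\<in>UNIV. h $ k * monom_partial k \<alpha> (($) x))"
  have "(pfun p has_derivative ?D) (at x)"
    unfolding pfun_expos[OF assms, abs_def]
    by (intro has_derivative_sum has_derivative_mult_right monom_value_has_derivative)
  then have "frechet_derivative (pfun p) (at x) = ?D"
    by (rule frechet_derivative_at[symmetric])
  moreover have "(\<Sum>k\<in>UNIV. axis i 1 $ k * monom_partial k \<alpha> (($) x)) = monom_partial i \<alpha> (($) x)" for \<alpha>
    by (simp add: axis_def if_distrib[of "\<lambda>r. r * _"] cong: if_cong)
  ultimately show ?thesis
    by (simp add: gradient_def)
qed

section \<open>Multipliers at critical points and the parametrization of critical inputs\<close>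

text \<open>Rank below the number of columns yields a nonzero kernel vector \<mu>. The
  \<open>Inr\<close> rows of the kernel equation give the products with the values, the
  \<open>Inl\<close> rows the relation between gradients.\<close>

lemma critical_point_multipliers:
  assumes "x \<in> critical_points g"
  obtains \<mu> j0 where "\<mu> j0 \<noteq> 0" "\<And>j. \<mu> j * pfun (g j) x = 0"
    "\<And>i. (\<Sum>j\<in>UNIV. \<mu> j * gradient (pfun (g j)) x $ i) = 0"
proof -
  have "\<not> inj ((*v) (phi g x))"
    using assms full_rank_injective[of "phi g x"] by (simp add: critical_points_def)
  then obtain \<mu> where \<mu>: "phi g x *v \<mu> = 0" "\<mu> \<noteq> 0"
    using matrix_left_invertible_ker[of "phi g x"] matrix_left_invertible_injective[of "phi g x"]
    by blast
  from \<mu>(2) obtain j0 where "\<mu> $ j0 \<noteq> 0"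
    by (auto simp: vec_eq_iff)
  moreover have "\<mu> $ j * pfun (g j) x = 0" for j
    using arg_cong[OF \<mu>(1), of "\<lambda>v. v $ Inr j"]
    by (simp add: matrix_vector_mult_def phi_def axis_def if_distrib[of "\<lambda>r. r * _"]
        if_distrib[of "\<lambda>r. _ * r"] mult.commute cong: if_cong)
  moreover have "(\<Sum>j\<in>UNIV. \<mu> $ j * gradient (pfun (g j)) x $ i) = 0" for i
    using arg_cong[OF \<mu>(1), of "\<lambda>v. v $ Inl i"]
    by (simp add: matrix_vector_mult_def phi_def mult.commute)
  ultimately show thesis
    using that[of "($) \<mu>"] by blast
qed

text \<open>
  Parametrization of the inputs having a critical point whose multiplier vector is normalized to
  \<open>-1\<close> at \<open>j0\<close> and has support \<open>J\<close>. Slots of the parameter vector that belong to coefficients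
  which are solved for are reused: \<open>(j0, unit_expo i)\<close> carries the \<open>i\<close>-th coordinate of
  the critical point, \<open>(j, 0)\<close> with \<open>j \<in> J - {j0}\<close> the \<open>j\<close>-th multiplier, and \<open>(j0, 0)\<close> is
  not used at all, which is the gain of one dimension.
\<close>

definition par_point :: "'m \<Rightarrow> ('m \<times> 'n expo \<Rightarrow> real) \<Rightarrow> 'n \<Rightarrow> real" where
  "par_point j0 t i = t (j0, unit_expo i)"

text \<open>This is the gradient equation with multiplier \<open>-1\<close> at \<open>j0\<close>,
  solved for the coefficient of the \<open>i\<close>-th variable in the polynomial at
  \<open>j0\<close>. The normalization avoids any division.\<close>

definition par_linear :: "('m \<Rightarrow> nat) \<Rightarrow> 'm set \<Rightarrow> 'm \<Rightarrow> ('m \<times> 'n::finite expo \<Rightarrow> real) \<Rightarrow> 'n \<Rightarrow> real" where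
  "par_linear d J j0 t i =
    (\<Sum>j\<in>J - {j0}. t (j, 0) * (\<Sum>\<alpha>\<in>expos_upto (d j) - {0}. t (j, \<alpha>) * monom_partial i \<alpha> (par_point j0 t)))
    - (\<Sum>\<alpha>\<in>high_expos (d j0). t (j0, \<alpha>) * monom_partial i \<alpha> (par_point j0 t))"

text \<open>The two branches for constant coefficients are the equations \<open>g j (x) = 0\<close>
  solved for the constant term, at \<open>j0\<close> and at the other indices in \<open>J\<close>;
  at \<open>j0\<close> the linear terms are those already solved for.\<close>

definition par_inputs ::
    "('m \<Rightarrow> nat) \<Rightarrow> 'm set \<times> 'm \<Rightarrow> ('m \<times> 'n::finite expo \<Rightarrow> real) \<Rightarrow> 'm \<times> 'n expo \<Rightarrow> real" where
  "par_inputs d = (\<lambda>(J, j0) t (j, \<alpha>).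
    if j = j0 then
      if \<alpha> = 0 then
        - (\<Sum>i\<in>UNIV. par_linear d J j0 t i * par_point j0 t i)
        - (\<Sum>\<alpha>\<in>high_expos (d j0). t (j0, \<alpha>) * monom_value \<alpha> (par_point j0 t))
      else if \<alpha> \<in> range unit_expo then par_linear d J j0 t (inv unit_expo \<alpha>)
      else t (j0, \<alpha>)
    else if j \<in> J \<and> \<alpha> = 0 then
      - (\<Sum>\<alpha>\<in>expos_upto (d j) - {0}. t (j, \<alpha>) * monom_value \<alpha> (par_point j0 t))
    else t (j, \<alpha>))"

lemma coeff_index_iff: "(j, \<alpha>) \<in> coeff_index d \<longleftrightarrow> \<alpha> \<in> expos_upto (d j)"
  by (simp add: coeff_index_def expos_upto_def)

lemma finite_coeff_index: "finite (coeff_index d :: ('m::finite \<times> 'n::finite expo) set)"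
proof -
  have "(coeff_index d :: ('m \<times> 'n expo) set) = Sigma UNIV (\<lambda>j. expos_upto (d j))"
    by (auto simp: coeff_index_iff)
  then show ?thesis
    by (simp add: finite_expos_upto)
qed

text \<open>Only sums, differences and products occur, and every slot read is an input index other
  than \<open>(j0, 0)\<close>. Positivity of the degrees makes the slots holding the point input
  indices.\<close>

lemma polynomial_on_par_inputs:
  fixes d :: "'m::finite \<Rightarrow> nat" and v :: "'m \<times> 'n::finite expo"
  assumes d: "\<And>j. d j > 0" and v: "v \<in> coeff_index d"
  shows "polynomial_on (coeff_index d - {(j0, 0)}) (\<lambda>t. par_inputs d (J, j0) t v)"
proof -
  let ?A = "coeff_index d - {(j0, 0)} :: ('m \<times> 'n expo) set"
  have var: "polynomial_on ?A (\<lambda>t. t (j, \<alpha>))"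
    if "\<alpha> \<in> expos_upto (d j)" "(j, \<alpha>) \<noteq> (j0, 0)" for j \<alpha>
    using that by (intro polynomial_on_var) (auto simp: finite_coeff_index coeff_index_iff)
  have point: "polynomial_on ?A (\<lambda>t. par_point j0 t i)" for i
    unfolding par_point_def using d by (intro var) (auto simp: unit_expo_in_expos_upto)
  have val: "polynomial_on ?A (\<lambda>t. monom_value \<alpha> (par_point j0 t))" for \<alpha>
    unfolding monom_value_def by (intro polynomial_on_prod polynomial_on_power point)
  have partial: "polynomial_on ?A (\<lambda>t. monom_partial i \<alpha> (par_point j0 t))" for i \<alpha>
    unfolding monom_partial_def
    by (intro polynomial_on_prod polynomial_on_power polynomial_on_mult polynomial_on_const point)
  have linear: "polynomial_on ?A (\<lambda>t. par_linear d J j0 t i)" for i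
    unfolding par_linear_def
    by (intro polynomial_on_diff polynomial_on_sum polynomial_on_mult partial var)
      (auto simp: high_expos_def)
  obtain j \<alpha> where "v = (j, \<alpha>)"
    by (cases v)
  moreover consider "j = j0" "\<alpha> = 0" | "j = j0" "\<alpha> \<noteq> 0" "\<alpha> \<in> range unit_expo"
    | "j = j0" "\<alpha> \<noteq> 0" "\<alpha> \<notin> range unit_expo" | "j \<noteq> j0" "j \<in> J \<and> \<alpha> = 0"
    | "j \<noteq> j0" "\<not> (j \<in> J \<and> \<alpha> = 0)"
    by blast
  then have "polynomial_on ?A (\<lambda>t. par_inputs d (J, j0) t (j, \<alpha>))"
  proof cases
    case 1
    then show ?thesis
      unfolding par_inputs_def
      by (simp, intro polynomial_on_diff polynomial_on_uminus polynomial_on_sum polynomial_on_mult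
          linear point val var) (auto simp: high_expos_def)
  next
    case 2
    then show ?thesis
      unfolding par_inputs_def by (simp only: prod.case if_True if_False simp_thms linear)
  next
    case 3
    then show ?thesis
      using v \<open>v = (j, \<alpha>)\<close> unfolding par_inputs_def
      by (simp only: prod.case if_True if_False simp_thms) (rule var, auto simp: coeff_index_iff)
  next
    case 4
    then show ?thesis
      unfolding par_inputs_def
      by (simp, intro polynomial_on_uminus polynomial_on_sum polynomial_on_mult val var) auto
  next
    case 5
    then show ?thesis
      using v \<open>v = (j, \<alpha>)\<close> unfolding par_inputs_def
      by (simp only: prod.case if_True if_False simp_thms) (rule var, auto simp: coeff_index_iff)
  qed
  ultimately show ?thesis
    by simp
qed

text \<open>The parameters are read off from a critical point and its multipliers, and the defining
  equations then recover every coefficient.\<close>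

lemma critical_inputs_parametrized:
  fixes d :: "'m::finite \<Rightarrow> nat" and g :: "'m \<Rightarrow> 'n::finite rpoly"
  assumes d: "\<And>j. d j > 0" and g: "\<And>j. g j \<in> polys_upto (d j)"
    and x: "x \<in> critical_points g"
  shows "\<exists>J j0 t. \<forall>v\<in>coeff_index d. coeff_data g v = par_inputs d (J, j0) t v"
proof -
  let ?x = "($) x"
  let ?c = "\<lambda>j \<alpha>. Poly_Mapping.lookup (g j) \<alpha>"
  obtain \<mu> j0 where j0: "\<mu> j0 \<noteq> 0" and val: "\<And>j. \<mu> j * pfun (g j) x = 0"
    and grad: "\<And>i. (\<Sum>j\<in>UNIV. \<mu> j * gradient (pfun (g j)) x $ i) = 0"
    using critical_point_multipliers[OF x] by blast
  define J where "J = {j. \<mu> j \<noteq> 0}"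
  \<comment> \<open>Scaling the multipliers by \<open>-1 / \<mu> j0\<close> produces the entry
    \<open>-1\<close> at \<open>j0\<close>. Division is allowed here, since only the existence of
    the parameters matters.\<close>
  define t where "t = (\<lambda>(j, \<alpha>).
    if j = j0 \<and> \<alpha> \<in> range unit_expo then ?x (inv unit_expo \<alpha>)
    else if j \<in> J - {j0} \<and> \<alpha> = 0 then - \<mu> j / \<mu> j0
    else ?c j \<alpha>)"
  have t_high: "t (j0, \<alpha>) = ?c j0 \<alpha>" if "\<alpha> \<notin> range unit_expo" for \<alpha>
    using that by (simp add: t_def)
  have t_other: "t (j, \<alpha>) = ?c j \<alpha>" if "j \<noteq> j0" "\<not> (j \<in> J \<and> \<alpha> = 0)" for j \<alpha>
    using that by (auto simp: t_def)
  have t_mult: "t (j, 0) = - \<mu> j / \<mu> j0" if "j \<in> J - {j0}" for j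
    using that by (simp add: t_def)
  have point: "par_point j0 t = ?x"
    by (auto simp: par_point_def t_def inv_f_f[OF inj_unit_expo])
  \<comment> \<open>A nonzero multiplier forces the value of its polynomial at \<open>x\<close> to
    be 0.\<close>
  have value_zero: "?c j 0 + (\<Sum>\<alpha>\<in>expos_upto (d j) - {0}. ?c j \<alpha> * monom_value \<alpha> ?x) = 0"
    if "j \<in> J" for j
    using that val[of j] by (simp add: J_def pfun_expos[OF g] sum_expos_upto)
  \<comment> \<open>The constant coefficient drops out of the gradient, which is why its slot can
    hold a multiplier.\<close>
  have gradient: "gradient (pfun (g j)) x $ i =
      (\<Sum>\<alpha>\<in>expos_upto (d j) - {0}. ?c j \<alpha> * monom_partial i \<alpha> ?x)" for i j
    by (simp add: gradient_expos[OF g] sum_expos_upto)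
  have gradient_j0: "gradient (pfun (g j0)) x $ i =
      ?c j0 (unit_expo i) + (\<Sum>\<alpha>\<in>high_expos (d j0). ?c j0 \<alpha> * monom_partial i \<alpha> ?x)" for i
    unfolding gradient sum_nonzero_expos[OF d] monom_partial_unit
    by (simp add: if_distrib[of "\<lambda>r. _ * r"] cong: if_cong)
  \<comment> \<open>The gradient relation is restricted to the support of \<mu> and solved for the
    gradient at \<open>j0\<close>; removing the part from \<open>high_expos\<close> leaves the
    linear coefficient.\<close>
  have linear: "par_linear d J j0 t i = ?c j0 (unit_expo i)" for i
  proof -
    have "(\<Sum>j\<in>UNIV. \<mu> j * gradient (pfun (g j)) x $ i) =
        (\<Sum>j\<in>J. \<mu> j * gradient (pfun (g j)) x $ i)"
      by (rule sum.mono_neutral_right) (auto simp: J_def)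
    also have "\<dots> = \<mu> j0 * gradient (pfun (g j0)) x $ i +
        (\<Sum>j\<in>J - {j0}. \<mu> j * gradient (pfun (g j)) x $ i)"
      using j0 by (intro sum.remove) (auto simp: J_def)
    finally have "gradient (pfun (g j0)) x $ i =
        - (\<Sum>j\<in>J - {j0}. \<mu> j * gradient (pfun (g j)) x $ i) / \<mu> j0"
      using grad[of i] j0 by (simp add: field_simps)
    also have "\<dots> = (\<Sum>j\<in>J - {j0}. (- \<mu> j / \<mu> j0) * gradient (pfun (g j)) x $ i)"
      by (simp add: sum_divide_distrib flip: sum_negf)
    also have "\<dots> = (\<Sum>j\<in>J - {j0}. t (j, 0) *
        (\<Sum>\<alpha>\<in>expos_upto (d j) - {0}. t (j, \<alpha>) * monom_partial i \<alpha> ?x))"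
      unfolding gradient by (intro sum.cong refl arg_cong2[where f = times]) (auto simp: t_mult t_other)
    finally show ?thesis
      unfolding par_linear_def point gradient_j0 by (simp add: t_high high_expos_def)
  qed
  have "coeff_data g (j, \<alpha>) = par_inputs d (J, j0) t (j, \<alpha>)" for j \<alpha>
  proof -
    consider "j = j0" "\<alpha> = 0" | i where "j = j0" "\<alpha> = unit_expo i"
      | "j = j0" "\<alpha> \<noteq> 0" "\<alpha> \<notin> range unit_expo" | "j \<noteq> j0" "j \<in> J \<and> \<alpha> = 0"
      | "j \<noteq> j0" "\<not> (j \<in> J \<and> \<alpha> = 0)"
      by blast
    then show ?thesis
    proof cases
      case 1
      have "j0 \<in> J"
        using j0 by (simp add: J_def)
      then show ?thesis
        using 1 value_zero[of j0] unfolding sum_nonzero_expos[OF d]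
        by (simp add: par_inputs_def coeff_data_def point linear t_high high_expos_def)
    next
      case 2
      then show ?thesis
        by (simp add: par_inputs_def coeff_data_def linear inv_f_f[OF inj_unit_expo])
    next
      case 3
      then show ?thesis
        by (simp add: par_inputs_def coeff_data_def t_high)
    next
      case 4
      then show ?thesis
        using value_zero[of j] by (simp add: par_inputs_def coeff_data_def point t_other)
    next
      case 5
      then show ?thesis
        by (simp only: par_inputs_def coeff_data_def prod.case if_False t_other[OF 5])
    qed
  qed
  then show ?thesis
    by (metis surj_pair)
qed

section \<open>One polynomial vanishing at all inputs that have critical points\<close>

theorem theorem2:
  fixes d :: "'m::finite \<Rightarrow> nat"
  assumes "\<And>j. d j > 0"
  shows "\<exists>\<psi> :: ('m \<times> 'n::finite expo) rpoly.
    \<psi> \<noteq> 0 \<and> pvars \<psi> \<subseteq> coeff_index d \<and>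
    (\<forall>g :: 'm \<Rightarrow> 'n rpoly.
      (\<forall>j. g j \<in> polys_upto (d j)) \<longrightarrow>
      peval (coeff_data g) \<psi> \<noteq> 0 \<longrightarrow>
      critical_points g = {})"
proof -
  define V :: "('m \<times> 'n expo) set" where "V = coeff_index d"
  have fin: "finite V"
    by (simp add: V_def finite_coeff_index)
  \<comment> \<open>The slot \<open>(j0, 0)\<close> is an input index, so leaving it out gives
    strictly fewer parameters than inputs.\<close>
  have card: "card (V - {(snd k, 0)}) < card V" for k :: "'m set \<times> 'm"
    using fin by (rule card_Diff1_less) (simp add: V_def coeff_index_iff)
  have poly: "polynomial_on (V - {(snd k, 0)}) (\<lambda>t. par_inputs d k t v)"
    if "v \<in> V" for k :: "'m set \<times> 'm" and v
    using polynomial_on_par_inputs[OF assms that[unfolded V_def], of "snd k" "fst k"]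
    by (simp add: V_def)
  \<comment> \<open>There are finitely many pairs \<open>(J, j0)\<close>, so one \<psi> handles all
    of them. Pairs with \<open>j0\<close> outside \<open>J\<close> are included too; they only add
    further images on which \<psi> vanishes.\<close>
  have "\<exists>\<psi>. \<psi> \<noteq> 0 \<and> pvars \<psi> \<subseteq> V \<and>
      (\<forall>k\<in>UNIV. \<forall>t y. (\<forall>v\<in>V. y v = par_inputs d k t v) \<longrightarrow> peval y \<psi> = 0)"
    by (rule exists_poly_vanishing_on_images[OF finite fin finite_Diff[OF fin] card poly])
  then obtain \<psi> where \<psi>: "\<psi> \<noteq> 0" "pvars \<psi> \<subseteq> V"
    and vanish: "\<And>k t y. \<forall>v\<in>V. y v = par_inputs d k t v \<Longrightarrow> peval y \<psi> = 0"
    by (metis UNIV_I)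
  have "critical_points g = {}"
    if g: "\<forall>j. g j \<in> polys_upto (d j)" and nonzero: "peval (coeff_data g) \<psi> \<noteq> 0" for g :: "'m \<Rightarrow> 'n rpoly"
  proof (rule equals0I)
    fix x
    assume "x \<in> critical_points g"
    then obtain J j0 t where "\<forall>v\<in>coeff_index d. coeff_data g v = par_inputs d (J, j0) t v"
      using critical_inputs_parametrized[of d g x, OF assms] g by blast
    then show False
      using vanish[of "coeff_data g" "(J, j0)" t] nonzero by (simp add: V_def)
  qed
  with \<psi> show ?thesis
    unfolding V_def by blast
qed

end
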